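(* Let $A$ be a ring that is either a Noetherian local ring or a standard graded ring, let $I\subset A$ be an ideal, and let $M$ be a non-zero $A$-module with $\operatorname{Supp}(M)\subset V(I)$ (in the graded case, $M$ is graded and $I$ is homogeneous). If $M$ is countably generated and has $I$-codepth at least $2$, then $M$ is quasi-cyclic.
   Context: A standard graded ring means a Noetherian graded ring generated by its degree-one elements over a field $A_0$; in the graded case all modules are graded and all ideals and elements are homogeneous. Coregular sequence: let $I$ be an ideal of $A$ and $M$ a non-zero $A$-module with $\operatorname{Supp}(M)\subset V(I)$. A sequence $x_1,\ldots,x_r$ of elements of $I$ is coregular for $M$ if $x_1M=M$ and, for each $1\le i\le r-1$, $x_{i+1}\,(0:_M(x_1,\ldots,x_i))=0:_M(x_1,\ldots,x_i)$. The $I$-codepth of $M$ is the supremum of the lengths of coregular sequences in $I$ for $M$. Quasi-cyclic: an $A$-module $M$ is quasi-cyclic if it is a countable increasing union of cyclic submodules; in the graded case the cyclic submodules are assumed to be generated by homogeneous elements. *)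

theory Defs
  imports
    "HOL-Algebra.Algebra"
    "HOL-Library.Countable_Set"
    "HOL-Library.Extended_Nat"
begin

section \<open>Rings and gradings\<close>

definition noetherian_local_ring :: "('a, 'r) ring_scheme \<Rightarrow> bool" where
  "noetherian_local_ring R \<longleftrightarrow> cring R \<and> noetherian_ring R \<and> (\<exists>!P. maximalideal P R)"

text \<open>Internal direct sum decomposition of the additive group of \<open>G\<close>; the multiplicative fields
  of \<open>G\<close> play no role, so this applies to rings and to modules.\<close>

definition internal_direct_sum :: "('b, 'm) ring_scheme \<Rightarrow> ('i \<Rightarrow> 'b set) \<Rightarrow> bool" where
  "internal_direct_sum G D \<longleftrightarrow>
     (\<forall>i. subgroup (D i) (add_monoid G)) \<and>
     (\<forall>x\<in>carrier G. \<exists>!c. (\<forall>i. c i \<in> D i) \<and> finite {i. c i \<noteq> \<zero>\<^bsub>G\<^esub>} \<and>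
        x = (\<Oplus>\<^bsub>G\<^esub>i\<in>{i. c i \<noteq> \<zero>\<^bsub>G\<^esub>}. c i))"

definition homogeneous :: "('i \<Rightarrow> 'b set) \<Rightarrow> 'b set" where
  "homogeneous D = (\<Union>i. D i)"

definition standard_graded_ring :: "('a, 'r) ring_scheme \<Rightarrow> (nat \<Rightarrow> 'a set) \<Rightarrow> bool" where
  "standard_graded_ring R A \<longleftrightarrow>
     cring R \<and> noetherian_ring R \<and>
     internal_direct_sum R A \<and>
     (\<forall>i j. \<forall>a\<in>A i. \<forall>b\<in>A j. a \<otimes>\<^bsub>R\<^esub> b \<in> A (i + j)) \<and>
     subfield (A 0) R \<and>
     carrier R = generate_ring R (A 0 \<union> A 1)"

text \<open>Modules over an \<open>\<nat>\<close>-graded ring are \<open>\<int>\<close>-graded, with no boundedness condition.\<close>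

definition graded_module ::
  "('a, 'r) ring_scheme \<Rightarrow> (nat \<Rightarrow> 'a set) \<Rightarrow> ('a, 'b, 'm) module_scheme \<Rightarrow> (int \<Rightarrow> 'b set) \<Rightarrow> bool"
where
  "graded_module R A M D \<longleftrightarrow>
     module R M \<and>
     internal_direct_sum M D \<and>
     (\<forall>i j. \<forall>a\<in>A i. \<forall>m\<in>D j. a \<odot>\<^bsub>M\<^esub> m \<in> D (int i + j))"

definition homogeneous_ideal ::
  "('a, 'r) ring_scheme \<Rightarrow> (nat \<Rightarrow> 'a set) \<Rightarrow> 'a set \<Rightarrow> bool" where
  "homogeneous_ideal R A I \<longleftrightarrow> ideal I R \<and> (\<exists>S\<subseteq>homogeneous A. I = Idl\<^bsub>R\<^esub> S)"


section \<open>Support\<close>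

definition zero_locus :: "('a, 'r) ring_scheme \<Rightarrow> 'a set \<Rightarrow> 'a set set" where
  "zero_locus R I = {P. primeideal P R \<and> I \<subseteq> P}"

definition localization_rel ::
  "('a, 'r) ring_scheme \<Rightarrow> ('a, 'b, 'm) module_scheme \<Rightarrow> 'a set \<Rightarrow> (('b \<times> 'a) \<times> ('b \<times> 'a)) set"
where
  "localization_rel R M P =
     {((m, s), (n, t)) | m s n t.
        m \<in> carrier M \<and> n \<in> carrier M \<and> s \<in> carrier R - P \<and> t \<in> carrier R - P \<and>
        (\<exists>u\<in>carrier R - P. u \<odot>\<^bsub>M\<^esub> (t \<odot>\<^bsub>M\<^esub> m \<ominus>\<^bsub>M\<^esub> s \<odot>\<^bsub>M\<^esub> n) = \<zero>\<^bsub>M\<^esub>)}"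

text \<open>The underlying set of \<open>M\<^sub>P\<close> (the class of \<open>(m, s)\<close> is the fraction \<open>m/s\<close>) and its zero
  element \<open>0/1\<close>. The module operations are not needed to say that \<open>M\<^sub>P\<close> is nonzero.\<close>

definition localization ::
  "('a, 'r) ring_scheme \<Rightarrow> ('a, 'b, 'm) module_scheme \<Rightarrow> 'a set \<Rightarrow> ('b \<times> 'a) set set" where
  "localization R M P = (carrier M \<times> (carrier R - P)) // localization_rel R M P"

definition localization_zero ::
  "('a, 'r) ring_scheme \<Rightarrow> ('a, 'b, 'm) module_scheme \<Rightarrow> 'a set \<Rightarrow> ('b \<times> 'a) set" where
  "localization_zero R M P = localization_rel R M P `` {(\<zero>\<^bsub>M\<^esub>, \<one>\<^bsub>R\<^esub>)}"

definition Supp :: "('a, 'r) ring_scheme \<Rightarrow> ('a, 'b, 'm) module_scheme \<Rightarrow> 'a set set" where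
  "Supp R M = {P. primeideal P R \<and> localization R M P \<noteq> {localization_zero R M P}}"


section \<open>Generation\<close>

definition gen_submodule ::
  "('a, 'r) ring_scheme \<Rightarrow> ('a, 'b, 'm) module_scheme \<Rightarrow> 'b set \<Rightarrow> 'b set" where
  "gen_submodule R M S = \<Inter>{N. submodule N R M \<and> S \<subseteq> N}"

definition countably_generated ::
  "('a, 'r) ring_scheme \<Rightarrow> ('a, 'b, 'm) module_scheme \<Rightarrow> bool" where
  "countably_generated R M \<longleftrightarrow>
     (\<exists>S\<subseteq>carrier M. countable S \<and> gen_submodule R M S = carrier M)"

text \<open>\<open>G\<close> is the set of elements allowed as generators of the cyclic submodules: all of \<open>M\<close>, or
  the homogeneous elements in the graded case.\<close>

definition quasi_cyclic_by ::
  "'b set \<Rightarrow> ('a, 'r) ring_scheme \<Rightarrow> ('a, 'b, 'm) module_scheme \<Rightarrow> bool" where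
  "quasi_cyclic_by G R M \<longleftrightarrow>
     (\<exists>N :: nat \<Rightarrow> 'b set.
        (\<forall>n. \<exists>z\<in>G. N n = gen_submodule R M {z}) \<and>
        (\<forall>n. N n \<subseteq> N (Suc n)) \<and>
        carrier M = (\<Union>n. N n))"

definition quasi_cyclic :: "('a, 'r) ring_scheme \<Rightarrow> ('a, 'b, 'm) module_scheme \<Rightarrow> bool" where
  "quasi_cyclic R M \<longleftrightarrow> quasi_cyclic_by (carrier M) R M"

definition graded_quasi_cyclic ::
  "('a, 'r) ring_scheme \<Rightarrow> ('a, 'b, 'm) module_scheme \<Rightarrow> (int \<Rightarrow> 'b set) \<Rightarrow> bool" where
  "graded_quasi_cyclic R M D \<longleftrightarrow> quasi_cyclic_by (homogeneous D) R M"


section \<open>Coregular sequences and codepth\<close>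

text \<open>\<open>0 :\<^sub>M (S)\<close>\<close>

definition annihilated_by :: "('a, 'b, 'm) module_scheme \<Rightarrow> 'a set \<Rightarrow> 'b set" where
  "annihilated_by M S = {m \<in> carrier M. \<forall>x\<in>S. x \<odot>\<^bsub>M\<^esub> m = \<zero>\<^bsub>M\<^esub>}"

text \<open>Lists are indexed from 0: \<open>xs ! i\<close> is \<open>x\<^sub>i\<^sub>+\<^sub>1\<close> and \<open>take i xs\<close> is \<open>x\<^sub>1, \<dots>, x\<^sub>i\<close>.
  The empty sequence is coregular.\<close>

definition coregular :: "('a, 'b, 'm) module_scheme \<Rightarrow> 'a list \<Rightarrow> bool" where
  "coregular M xs \<longleftrightarrow>
     (xs \<noteq> [] \<longrightarrow> (\<lambda>m. xs ! 0 \<odot>\<^bsub>M\<^esub> m) ` carrier M = carrier M) \<and>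
     (\<forall>i. 1 \<le> i \<and> i < length xs \<longrightarrow>
        (\<lambda>m. xs ! i \<odot>\<^bsub>M\<^esub> m) ` annihilated_by M (set (take i xs))
          = annihilated_by M (set (take i xs)))"

text \<open>The \<open>I\<close>-codepth of \<open>M\<close>. In the graded case, coregular sequences consist of homogeneous
  elements.\<close>

definition codepth :: "'a set \<Rightarrow> ('a, 'b, 'm) module_scheme \<Rightarrow> enat" where
  "codepth I M = (SUP xs\<in>{xs. set xs \<subseteq> I \<and> coregular M xs}. enat (length xs))"

definition graded_codepth ::
  "(nat \<Rightarrow> 'a set) \<Rightarrow> 'a set \<Rightarrow> ('a, 'b, 'm) module_scheme \<Rightarrow> enat" where
  "graded_codepth A I M =
     (SUP xs\<in>{xs. set xs \<subseteq> I \<inter> homogeneous A \<and> coregular M xs}. enat (length xs))"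

end

theory Submission
  imports Defs
begin

text \<open>
  If \<open>x, y\<close> is coregular then so is \<open>x\<^sup>n, y\<^sup>m\<close>, and this says that the Koszul complex
  \<open>M \<rightarrow> M\<^sup>2 \<rightarrow> M\<close>, \<open>z \<mapsto> (x\<^sup>n z, y\<^sup>m z)\<close>, \<open>(u, v) \<mapsto> y\<^sup>m u - x\<^sup>n v\<close>, is exact in the middle. The support
  condition makes \<open>x\<close> and \<open>y\<close> locally nilpotent on \<open>M\<close>, so for given \<open>u, v\<close> and large \<open>n, m\<close> the pair
  \<open>(u, v)\<close> is a cycle, and \<open>u\<close> and \<open>v\<close> are multiples of a single \<open>z\<close>. Enumerating a countable set of
  generators then yields the chain of cyclic submodules.

  In the graded case \<open>x\<close> and \<open>y\<close> have positive degrees \<open>a\<close> and \<open>b\<close>, and \<open>z\<close> can be chosen homogeneous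
  as soon as \<open>deg u \<equiv> deg v\<close> modulo \<open>a b\<close>. An arbitrary homogeneous \<open>v\<close> equals \<open>x\<^sup>k v'\<close>, and since the
  ring is generated in degree one, \<open>x\<^sup>k v'\<close> is a combination of elements whose degree lies in the
  residue class of \<open>deg u\<close>; these finitely many elements and \<open>u\<close> lie in one cyclic submodule.
\<close>

section \<open>Prime ideals avoiding the powers of an element\<close>

text \<open>Zorn's lemma gives an ideal that is maximal among those that contain \<open>J\<close>
  and no power of \<open>x\<close>; maximality forces it to be prime. With \<open>J\<close> the
  annihilator of an element, this produces a point of the support.\<close>

lemma (in cring) primeideal_avoiding_powers:
  assumes "ideal J R" "x \<in> carrier R" "\<And>n::nat. x [^] n \<notin> J"
  obtains P where "primeideal P R" "J \<subseteq> P" "x \<notin> P"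
proof -
  define F where "F = {K. ideal K R \<and> J \<subseteq> K \<and> (\<forall>n::nat. x [^] n \<notin> K)}"
  have "\<exists>P\<in>F. \<forall>K\<in>F. P \<subseteq> K \<longrightarrow> K = P"
  proof (rule subset_Zorn_nonempty)
    have "J \<in> F" using assms unfolding F_def by simp
    then show "F \<noteq> {}" by blast
    fix C assume C: "C \<noteq> {}" "subset.chain F C"
    have "subset.chain {K. ideal K R} C"
      using C(2) unfolding F_def pred_on.chain_def by blast
    from chain_Union_is_ideal[OF this] have "ideal (\<Union>C) R"
      using C(1) by simp
    moreover have "C \<subseteq> F" using C(2) unfolding pred_on.chain_def by blast
    ultimately show "\<Union>C \<in> F" using C(1) unfolding F_def by blast
  qed
  then obtain P where "P \<in> F" and max: "\<And>K. K \<in> F \<Longrightarrow> P \<subseteq> K \<Longrightarrow> K = P"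
    by blast
  from \<open>P \<in> F\<close> have P: "ideal P R" "J \<subseteq> P" "\<And>n::nat. x [^] n \<notin> P"
    unfolding F_def by simp_all
  interpret P: ideal P R by fact
  \<comment> \<open>By maximality, adjoining any \<open>a\<close> outside \<open>P\<close> creates
    an ideal that contains a power of \<open>x\<close>.\<close>
  have hit: "\<exists>n::nat. \<exists>p\<in>P. \<exists>r\<in>carrier R. x [^] n = p \<oplus> r \<otimes> a"
    if a: "a \<in> carrier R" "a \<notin> P" for a
  proof -
    let ?K = "P <+>\<^bsub>R\<^esub> PIdl a"
    have K: "ideal ?K R" using add_ideals[OF P(1) cgenideal_ideal[OF a(1)]] .
    have mem: "k \<in> ?K \<longleftrightarrow> (\<exists>p\<in>P. \<exists>r\<in>carrier R. k = p \<oplus> r \<otimes> a)" for k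
      unfolding set_add_def' cgenideal_def by blast
    have "P \<subseteq> ?K"
    proof
      fix p assume "p \<in> P"
      moreover have "p = p \<oplus> \<zero> \<otimes> a" using a \<open>p \<in> P\<close> P.Icarr by simp
      ultimately show "p \<in> ?K" using mem by blast
    qed
    moreover have "a \<in> ?K"
    proof -
      have "a = \<zero> \<oplus> \<one> \<otimes> a" using a by simp
      then show ?thesis using mem P.zero_closed by blast
    qed
    ultimately have "?K \<notin> F" using max a(2) by blast
    then have "\<exists>n::nat. x [^] n \<in> ?K"
      using K P(2) \<open>P \<subseteq> ?K\<close> unfolding F_def by blast
    then show ?thesis using mem by blast
  qed
  have "primeideal P R"
  proof (rule primeidealI[OF P(1) is_cring])
    show "carrier R \<noteq> P" using P(3)[of 0] by auto
    fix a b assume ab: "a \<in> carrier R" "b \<in> carrier R" "a \<otimes> b \<in> P"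
    show "a \<in> P \<or> b \<in> P"
    proof (rule ccontr)
      assume "\<not> (a \<in> P \<or> b \<in> P)"
      then have nab: "a \<notin> P" "b \<notin> P" by auto
      obtain n m :: nat and p q r s where
        *: "p \<in> P" "r \<in> carrier R" "x [^] n = p \<oplus> r \<otimes> a"
           "q \<in> P" "s \<in> carrier R" "x [^] m = q \<oplus> s \<otimes> b"
        using hit[OF ab(1) nab(1)] hit[OF ab(2) nab(2)] by blast
      have pq: "p \<in> carrier R" "q \<in> carrier R" using * P.Icarr by auto
      \<comment> \<open>In the expanded product every term has a factor \<open>p\<close>,
        \<open>q\<close> or \<open>a \<otimes> b\<close>, all of which lie in
        \<open>P\<close>.\<close>
      have "x [^] (n + m) = (p \<oplus> r \<otimes> a) \<otimes> (q \<oplus> s \<otimes> b)"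
        using *(3,6) assms(2) by (simp add: nat_pow_mult[symmetric])
      also have "\<dots> = (q \<oplus> s \<otimes> b) \<otimes> p \<oplus> (r \<otimes> a) \<otimes> q \<oplus> (r \<otimes> s) \<otimes> (a \<otimes> b)"
        using pq ab(1,2) *(2,5)
        by (simp add: l_distr r_distr m_ac a_ac)
      also have "\<dots> \<in> P"
        using *(1,2,4,5) pq ab by (simp add: P.a_closed P.I_l_closed)
      finally show False using P(3) by blast
    qed
  qed
  moreover have "x \<notin> P" using P(3)[of 1] assms(2) by simp
  ultimately show thesis using that P(2) by blast
qed

section \<open>Support and local nilpotence\<close>

context module
begin

lemma smult_pow_Suc:
  assumes "x \<in> carrier R" "m \<in> carrier M"
  shows "x [^] Suc n \<odot>\<^bsub>M\<^esub> m = x [^] n \<odot>\<^bsub>M\<^esub> (x \<odot>\<^bsub>M\<^esub> m)"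
  using assms by (simp add: smult_assoc1)

lemma smult_pow_Suc2:
  assumes "x \<in> carrier R" "m \<in> carrier M"
  shows "x [^] Suc n \<odot>\<^bsub>M\<^esub> m = x \<odot>\<^bsub>M\<^esub> (x [^] n \<odot>\<^bsub>M\<^esub> m)"
  using assms by (metis R.nat_pow_Suc2 R.nat_pow_closed smult_assoc1)

lemma smult_commute:
  assumes "x \<in> carrier R" "y \<in> carrier R" "m \<in> carrier M"
  shows "x \<odot>\<^bsub>M\<^esub> (y \<odot>\<^bsub>M\<^esub> m) = y \<odot>\<^bsub>M\<^esub> (x \<odot>\<^bsub>M\<^esub> m)"
  using assms by (metis R.m_comm smult_assoc1)

lemma ann_ideal:
  assumes m: "m \<in> carrier M"
  shows "ideal {a \<in> carrier R. a \<odot>\<^bsub>M\<^esub> m = \<zero>\<^bsub>M\<^esub>} R"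
proof (rule idealI[OF R.ring_axioms])
  show "subgroup {a \<in> carrier R. a \<odot>\<^bsub>M\<^esub> m = \<zero>\<^bsub>M\<^esub>} (add_monoid R)"
  proof (rule R.add.subgroupI)
    show "{a \<in> carrier R. a \<odot>\<^bsub>M\<^esub> m = \<zero>\<^bsub>M\<^esub>} \<noteq> {}"
      using m smult_l_null by blast
  qed (use m in \<open>auto simp: smult_l_minus smult_l_distr simp flip: a_inv_def\<close>)
next
  fix a r assume a: "a \<in> {a \<in> carrier R. a \<odot>\<^bsub>M\<^esub> m = \<zero>\<^bsub>M\<^esub>}" and r: "r \<in> carrier R"
  show ra: "r \<otimes> a \<in> {a \<in> carrier R. a \<odot>\<^bsub>M\<^esub> m = \<zero>\<^bsub>M\<^esub>}"
    using a r m by (simp add: smult_assoc1)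
  show "a \<otimes> r \<in> {a \<in> carrier R. a \<odot>\<^bsub>M\<^esub> m = \<zero>\<^bsub>M\<^esub>}"
    using ra a r R.m_comm by simp
qed

text \<open>The fraction m/1 is nonzero in the localization: it could vanish only if some
  \<open>u\<close> outside \<open>P\<close> killed \<open>m\<close>, but the annihilator of
  \<open>m\<close> lies inside \<open>P\<close>.\<close>

lemma Supp_if_ann_subset:
  assumes m: "m \<in> carrier M" and P: "primeideal P R"
    and ann: "{a \<in> carrier R. a \<odot>\<^bsub>M\<^esub> m = \<zero>\<^bsub>M\<^esub>} \<subseteq> P"
  shows "P \<in> Supp R M"
proof -
  interpret P: primeideal P R by fact
  have one: "\<one> \<in> carrier R - P"
    using P.one_imp_carrier P.I_notcarr by auto
  let ?c = "localization_rel R M P `` {(m, \<one>)}"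
  have rel: "((n, s), (n', t)) \<in> localization_rel R M P \<longleftrightarrow>
      n \<in> carrier M \<and> n' \<in> carrier M \<and> s \<in> carrier R - P \<and> t \<in> carrier R - P \<and>
      (\<exists>u\<in>carrier R - P. u \<odot>\<^bsub>M\<^esub> (t \<odot>\<^bsub>M\<^esub> n \<ominus>\<^bsub>M\<^esub> s \<odot>\<^bsub>M\<^esub> n') = \<zero>\<^bsub>M\<^esub>)" for n s n' t
    unfolding localization_rel_def by simp
  have "?c \<in> localization R M P"
    unfolding localization_def using m one by (intro quotientI) simp
  moreover have "?c \<noteq> localization_zero R M P"
  proof
    assume eq: "?c = localization_zero R M P"
    \<comment> \<open>Reflexivity at \<open>(m, \<one>)\<close> puts this pair into
      \<open>?c\<close>; the assumed equality of classes then relates it to 0/1.\<close>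
    have "\<one> \<odot>\<^bsub>M\<^esub> (\<one> \<odot>\<^bsub>M\<^esub> m \<ominus>\<^bsub>M\<^esub> \<one> \<odot>\<^bsub>M\<^esub> m) = \<zero>\<^bsub>M\<^esub>"
      using m by (simp add: a_minus_def M.r_neg)
    then have "\<exists>u\<in>carrier R - P. u \<odot>\<^bsub>M\<^esub> (\<one> \<odot>\<^bsub>M\<^esub> m \<ominus>\<^bsub>M\<^esub> \<one> \<odot>\<^bsub>M\<^esub> m) = \<zero>\<^bsub>M\<^esub>"
      using one by (rule bexI)
    then have "(m, \<one>) \<in> ?c" using m one by (simp only: Image_singleton_iff rel)
    then have "((\<zero>\<^bsub>M\<^esub>, \<one>), (m, \<one>)) \<in> localization_rel R M P"
      by (simp only: eq localization_zero_def Image_singleton_iff)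
    then obtain u where u: "u \<in> carrier R - P"
      and "u \<odot>\<^bsub>M\<^esub> (\<one> \<odot>\<^bsub>M\<^esub> \<zero>\<^bsub>M\<^esub> \<ominus>\<^bsub>M\<^esub> \<one> \<odot>\<^bsub>M\<^esub> m) = \<zero>\<^bsub>M\<^esub>"
      unfolding rel by (elim conjE bexE)
    then have "\<ominus>\<^bsub>M\<^esub> (u \<odot>\<^bsub>M\<^esub> m) = \<zero>\<^bsub>M\<^esub>"
      using m by (simp add: a_minus_def smult_r_minus)
    moreover have "u \<odot>\<^bsub>M\<^esub> m \<oplus>\<^bsub>M\<^esub> \<ominus>\<^bsub>M\<^esub> (u \<odot>\<^bsub>M\<^esub> m) = \<zero>\<^bsub>M\<^esub>"
      using m u by (simp add: M.r_neg)
    ultimately have "u \<odot>\<^bsub>M\<^esub> m = \<zero>\<^bsub>M\<^esub>"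
      using m u by simp
    then show False using ann u by blast
  qed
  ultimately have "localization R M P \<noteq> {localization_zero R M P}" by auto
  then show ?thesis using P by (simp add: Supp_def)
qed

text \<open>If no power of \<open>x\<close> killed \<open>m\<close>, some prime would contain the
  annihilator of \<open>m\<close> but not \<open>x\<close>. Such a prime lies in the support, hence
  contains \<open>I\<close> and with it \<open>x\<close>.\<close>

lemma locally_nilpotent:
  assumes "Supp R M \<subseteq> zero_locus R I" "x \<in> I" "x \<in> carrier R" "m \<in> carrier M"
  shows "\<exists>n::nat. x [^] n \<odot>\<^bsub>M\<^esub> m = \<zero>\<^bsub>M\<^esub>"
proof (rule ccontr)
  let ?J = "{a \<in> carrier R. a \<odot>\<^bsub>M\<^esub> m = \<zero>\<^bsub>M\<^esub>}"
  assume "\<not> ?thesis"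
  then obtain P where P: "primeideal P R" "?J \<subseteq> P" "x \<notin> P"
    using R.primeideal_avoiding_powers[OF ann_ideal[OF assms(4)] assms(3)] by blast
  then have "P \<in> zero_locus R I"
    using Supp_if_ann_subset[OF assms(4)] assms(1) by blast
  then show False using P(3) assms(2) unfolding zero_locus_def by blast
qed

lemma pow_smult_zero_mono:
  assumes "x \<in> carrier R" "m \<in> carrier M" "x [^] (n::nat) \<odot>\<^bsub>M\<^esub> m = \<zero>\<^bsub>M\<^esub>" "n \<le> k"
  shows "x [^] k \<odot>\<^bsub>M\<^esub> m = \<zero>\<^bsub>M\<^esub>"
proof -
  have "x [^] k = x [^] (k - n) \<otimes> x [^] n"
    using assms(1,4) by (simp add: R.nat_pow_mult)
  then show ?thesis using assms(1-3) by (simp add: smult_assoc1)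
qed

section \<open>Exactness of the Koszul complex of a coregular pair\<close>

text \<open>The subset \<open>N\<close> is kept general because the lemma serves twice: for
  \<open>x\<close> on all of \<open>M\<close>, and for \<open>y\<close> on the kernel of a power of
  \<open>x\<close>.\<close>

lemma pow_smult_surj:
  assumes x: "x \<in> carrier R"
    and N: "N \<subseteq> carrier M" "\<And>m. m \<in> N \<Longrightarrow> \<exists>m'\<in>N. x \<odot>\<^bsub>M\<^esub> m' = m"
    and "m \<in> N"
  shows "\<exists>m'\<in>N. x [^] (n::nat) \<odot>\<^bsub>M\<^esub> m' = m"
  using \<open>m \<in> N\<close>
proof (induction n arbitrary: m)
  case 0
  then show ?case using N(1) smult_one by (metis R.nat_pow_0 subsetD)
next
  case (Suc n)
  then obtain m1 where m1: "m1 \<in> N" "x [^] n \<odot>\<^bsub>M\<^esub> m1 = m" by blast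
  then obtain m2 where "m2 \<in> N" "x \<odot>\<^bsub>M\<^esub> m2 = m1" using N(2) by blast
  moreover have "x [^] Suc n \<odot>\<^bsub>M\<^esub> m2 = m"
    using m1 calculation N(1) smult_pow_Suc[OF x, of m2 n] by auto
  ultimately show ?case by blast
qed

text \<open>Induction on \<open>n\<close>: since \<open>x\<close> is surjective, it maps the kernel
  of x^(n+1) onto the kernel of x^n, and the kernel of this map is the kernel of \<open>x\<close>.
  Surjectivity of \<open>y\<close> on both ends gives it in the middle.\<close>

lemma smult_surj_on_pow_kernel:
  assumes xy: "x \<in> carrier R" "y \<in> carrier R"
    and surj: "\<And>m. m \<in> carrier M \<Longrightarrow> \<exists>m'\<in>carrier M. x \<odot>\<^bsub>M\<^esub> m' = m"
    and ker: "\<And>t. t \<in> carrier M \<Longrightarrow> x \<odot>\<^bsub>M\<^esub> t = \<zero>\<^bsub>M\<^esub> \<Longrightarrow>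
        \<exists>s\<in>carrier M. x \<odot>\<^bsub>M\<^esub> s = \<zero>\<^bsub>M\<^esub> \<and> y \<odot>\<^bsub>M\<^esub> s = t"
    and "t \<in> carrier M" "x [^] (n::nat) \<odot>\<^bsub>M\<^esub> t = \<zero>\<^bsub>M\<^esub>"
  shows "\<exists>s\<in>carrier M. x [^] n \<odot>\<^bsub>M\<^esub> s = \<zero>\<^bsub>M\<^esub> \<and> y \<odot>\<^bsub>M\<^esub> s = t"
  using assms(5,6)
proof (induction n arbitrary: t)
  case 0
  then show ?case using xy by auto
next
  case (Suc n)
  have "x [^] n \<odot>\<^bsub>M\<^esub> (x \<odot>\<^bsub>M\<^esub> t) = \<zero>\<^bsub>M\<^esub>"
    using Suc.prems xy smult_pow_Suc by metis
  then obtain s1 where s1: "s1 \<in> carrier M" "x [^] n \<odot>\<^bsub>M\<^esub> s1 = \<zero>\<^bsub>M\<^esub>" "y \<odot>\<^bsub>M\<^esub> s1 = x \<odot>\<^bsub>M\<^esub> t"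
    using Suc.IH[of "x \<odot>\<^bsub>M\<^esub> t"] Suc.prems(1) xy by auto
  obtain s2 where s2: "s2 \<in> carrier M" "x \<odot>\<^bsub>M\<^esub> s2 = s1" using surj s1(1) by blast
  \<comment> \<open>\<open>s2\<close> solves the problem only after multiplication by
    \<open>x\<close>. The error \<open>?t\<close> is killed by \<open>x\<close>, so
    \<open>ker\<close> supplies a correction \<open>r\<close>.\<close>
  let ?t = "t \<oplus>\<^bsub>M\<^esub> \<ominus>\<^bsub>M\<^esub> (y \<odot>\<^bsub>M\<^esub> s2)"
  have "x \<odot>\<^bsub>M\<^esub> (y \<odot>\<^bsub>M\<^esub> s2) = x \<odot>\<^bsub>M\<^esub> t"
    using s1 s2 xy smult_commute by metis
  then have "x \<odot>\<^bsub>M\<^esub> ?t = \<zero>\<^bsub>M\<^esub>"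
    using xy s2 Suc.prems(1) by (simp add: smult_r_distr smult_r_minus M.r_neg)
  then obtain r where r: "r \<in> carrier M" "x \<odot>\<^bsub>M\<^esub> r = \<zero>\<^bsub>M\<^esub>" "y \<odot>\<^bsub>M\<^esub> r = ?t"
    using ker[of ?t] xy s2 Suc.prems(1) by auto
  have "x [^] Suc n \<odot>\<^bsub>M\<^esub> (s2 \<oplus>\<^bsub>M\<^esub> r) = x [^] n \<odot>\<^bsub>M\<^esub> (x \<odot>\<^bsub>M\<^esub> (s2 \<oplus>\<^bsub>M\<^esub> r))"
    using smult_pow_Suc xy s2 r by simp
  also have "\<dots> = \<zero>\<^bsub>M\<^esub>"
    using xy s1 s2 r by (simp add: smult_r_distr)
  finally have "x [^] Suc n \<odot>\<^bsub>M\<^esub> (s2 \<oplus>\<^bsub>M\<^esub> r) = \<zero>\<^bsub>M\<^esub>" .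
  moreover have "y \<odot>\<^bsub>M\<^esub> (s2 \<oplus>\<^bsub>M\<^esub> r) = t"
  proof -
    have "y \<odot>\<^bsub>M\<^esub> (s2 \<oplus>\<^bsub>M\<^esub> r) = y \<odot>\<^bsub>M\<^esub> s2 \<oplus>\<^bsub>M\<^esub> ?t"
      using xy s2 r by (simp add: smult_r_distr)
    also have "\<dots> = t \<oplus>\<^bsub>M\<^esub> (y \<odot>\<^bsub>M\<^esub> s2 \<oplus>\<^bsub>M\<^esub> \<ominus>\<^bsub>M\<^esub> (y \<odot>\<^bsub>M\<^esub> s2))"
      using xy s2 Suc.prems(1) by (simp add: M.a_lcomm)
    finally show ?thesis using xy s2 Suc.prems(1) by (simp add: M.r_neg)
  qed
  ultimately show ?case using s2 r by blast
qed

text \<open>Choose \<open>w\<close> with x^n w = u. By the cycle condition x^n kills v - y^m w,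
  which is therefore y^m s for some \<open>s\<close> killed by x^n, and z = w + s solves both
  equations.\<close>

lemma koszul_exact:
  assumes xy: "x \<in> carrier R" "y \<in> carrier R"
    and surj: "\<And>m. m \<in> carrier M \<Longrightarrow> \<exists>m'\<in>carrier M. x \<odot>\<^bsub>M\<^esub> m' = m"
    and ker: "\<And>t. t \<in> carrier M \<Longrightarrow> x \<odot>\<^bsub>M\<^esub> t = \<zero>\<^bsub>M\<^esub> \<Longrightarrow>
        \<exists>s\<in>carrier M. x \<odot>\<^bsub>M\<^esub> s = \<zero>\<^bsub>M\<^esub> \<and> y \<odot>\<^bsub>M\<^esub> s = t"
    and uv: "u \<in> carrier M" "v \<in> carrier M"
    and cycle: "y [^] (m::nat) \<odot>\<^bsub>M\<^esub> u = x [^] (n::nat) \<odot>\<^bsub>M\<^esub> v"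
  shows "\<exists>z\<in>carrier M. x [^] n \<odot>\<^bsub>M\<^esub> z = u \<and> y [^] m \<odot>\<^bsub>M\<^esub> z = v"
proof -
  obtain w where w: "w \<in> carrier M" "x [^] n \<odot>\<^bsub>M\<^esub> w = u"
    using pow_smult_surj[OF xy(1) subset_refl surj uv(1)] by blast
  let ?K = "{s \<in> carrier M. x [^] n \<odot>\<^bsub>M\<^esub> s = \<zero>\<^bsub>M\<^esub>}"
  let ?t = "v \<oplus>\<^bsub>M\<^esub> \<ominus>\<^bsub>M\<^esub> (y [^] m \<odot>\<^bsub>M\<^esub> w)"
  have "x [^] n \<odot>\<^bsub>M\<^esub> (y [^] m \<odot>\<^bsub>M\<^esub> w) = x [^] n \<odot>\<^bsub>M\<^esub> v"
    using w xy cycle smult_commute by (metis R.nat_pow_closed)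
  then have "?t \<in> ?K"
    using xy w uv by (simp add: smult_r_distr smult_r_minus M.r_neg)
  moreover have "\<exists>s'\<in>?K. y \<odot>\<^bsub>M\<^esub> s' = s" if "s \<in> ?K" for s
    using smult_surj_on_pow_kernel[OF xy surj ker, of s n] that by blast
  ultimately have "\<exists>s\<in>?K. y [^] m \<odot>\<^bsub>M\<^esub> s = ?t"
    using pow_smult_surj[OF xy(2), of ?K ?t m] by blast
  then obtain s where s: "s \<in> carrier M" "x [^] n \<odot>\<^bsub>M\<^esub> s = \<zero>\<^bsub>M\<^esub>" "y [^] m \<odot>\<^bsub>M\<^esub> s = ?t"
    by blast
  have "x [^] n \<odot>\<^bsub>M\<^esub> (w \<oplus>\<^bsub>M\<^esub> s) = u"
    using xy w s uv by (simp add: smult_r_distr)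
  moreover have "y [^] m \<odot>\<^bsub>M\<^esub> (w \<oplus>\<^bsub>M\<^esub> s) = v"
  proof -
    have "y [^] m \<odot>\<^bsub>M\<^esub> (w \<oplus>\<^bsub>M\<^esub> s) = v \<oplus>\<^bsub>M\<^esub> (y [^] m \<odot>\<^bsub>M\<^esub> w \<oplus>\<^bsub>M\<^esub> \<ominus>\<^bsub>M\<^esub> (y [^] m \<odot>\<^bsub>M\<^esub> w))"
      using xy w s uv by (simp add: smult_r_distr M.a_lcomm)
    then show ?thesis using xy w uv by (simp add: M.r_neg)
  qed
  ultimately show ?thesis using w s by blast
qed

section \<open>Cyclic submodules and ascending chains\<close>

lemma gen_submodule_minimal:
  assumes "submodule N R M" "S \<subseteq> N"
  shows "gen_submodule R M S \<subseteq> N"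
  using assms unfolding gen_submodule_def by blast

lemma gen_submodule_singleton:
  assumes z: "z \<in> carrier M"
  shows "gen_submodule R M {z} = {a \<odot>\<^bsub>M\<^esub> z | a. a \<in> carrier R}"
proof
  have "submodule {a \<odot>\<^bsub>M\<^esub> z | a. a \<in> carrier R} R M"
  proof (rule submoduleI)
    show "\<zero>\<^bsub>M\<^esub> \<in> {a \<odot>\<^bsub>M\<^esub> z | a. a \<in> carrier R}"
      using z by (metis (mono_tags, lifting) R.zero_closed mem_Collect_eq smult_l_null)
    fix u assume "u \<in> {a \<odot>\<^bsub>M\<^esub> z | a. a \<in> carrier R}"
    then obtain a where a: "a \<in> carrier R" "u = a \<odot>\<^bsub>M\<^esub> z" by blast
    show "\<ominus>\<^bsub>M\<^esub> u \<in> {a \<odot>\<^bsub>M\<^esub> z | a. a \<in> carrier R}"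
      using a z smult_l_minus[of a z] by (auto intro!: exI[of _ "\<ominus> a"])
    show "b \<odot>\<^bsub>M\<^esub> u \<in> {a \<odot>\<^bsub>M\<^esub> z | a. a \<in> carrier R}" if "b \<in> carrier R" for b
      using a z that smult_assoc1[of b a z] by (auto intro!: exI[of _ "b \<otimes> a"])
    fix v assume "v \<in> {a \<odot>\<^bsub>M\<^esub> z | a. a \<in> carrier R}"
    then obtain b where b: "b \<in> carrier R" "v = b \<odot>\<^bsub>M\<^esub> z" by blast
    show "u \<oplus>\<^bsub>M\<^esub> v \<in> {a \<odot>\<^bsub>M\<^esub> z | a. a \<in> carrier R}"
      using a b z smult_l_distr[of a b z] by (auto intro!: exI[of _ "a \<oplus> b"])
  qed (use z in auto)
  moreover have "z \<in> {a \<odot>\<^bsub>M\<^esub> z | a. a \<in> carrier R}"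
    using z by (auto intro!: exI[of _ \<one>])
  ultimately show "gen_submodule R M {z} \<subseteq> {a \<odot>\<^bsub>M\<^esub> z | a. a \<in> carrier R}"
    by (intro gen_submodule_minimal) auto
  show "{a \<odot>\<^bsub>M\<^esub> z | a. a \<in> carrier R} \<subseteq> gen_submodule R M {z}"
    unfolding gen_submodule_def using submoduleE(4) by auto
qed

lemma submodule_chain_Union:
  fixes N :: "nat \<Rightarrow> 'c set"
  assumes sub: "\<And>n. submodule (N n) R M" and inc: "\<And>n. N n \<subseteq> N (Suc n)"
  shows "submodule (\<Union>n. N n) R M"
proof (rule submoduleI)
  have mono: "N i \<subseteq> N j" if "i \<le> j" for i j
    using lift_Suc_mono_le[of N, OF inc that] .
  note E = submoduleE[OF sub]
  show "(\<Union>n. N n) \<subseteq> carrier M" using E(1) by blast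
  show "\<zero>\<^bsub>M\<^esub> \<in> (\<Union>n. N n)"
    using subgroup.one_closed[OF submodule.axioms(1)[OF sub]] by simp
  show "\<ominus>\<^bsub>M\<^esub> u \<in> (\<Union>n. N n)" if "u \<in> (\<Union>n. N n)" for u
    using that E(3) by blast
  show "b \<odot>\<^bsub>M\<^esub> u \<in> (\<Union>n. N n)" if "b \<in> carrier R" "u \<in> (\<Union>n. N n)" for b u
    using that E(4) by blast
  fix u v assume "u \<in> (\<Union>n. N n)" "v \<in> (\<Union>n. N n)"
  then obtain i j where "u \<in> N i" "v \<in> N j" by blast
  then have "u \<in> N (max i j)" "v \<in> N (max i j)"
    using mono[of i "max i j"] mono[of j "max i j"] by auto
  then show "u \<oplus>\<^bsub>M\<^esub> v \<in> (\<Union>n. N n)" using E(5) by blast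
qed

lemma gen_submodule_is_submodule:
  assumes "S \<subseteq> carrier M"
  shows "submodule (gen_submodule R M S) R M"
proof (rule submoduleI)
  have zero: "\<zero>\<^bsub>M\<^esub> \<in> N" if "submodule N R M" for N
    using subgroup.one_closed[OF submodule.axioms(1)[OF that]] by simp
  then show "\<zero>\<^bsub>M\<^esub> \<in> gen_submodule R M S" unfolding gen_submodule_def by blast
  show "gen_submodule R M S \<subseteq> carrier M"
    using gen_submodule_minimal[OF carrier_is_submodule assms] .
  show "\<ominus>\<^bsub>M\<^esub> u \<in> gen_submodule R M S" if "u \<in> gen_submodule R M S" for u
    using that submoduleE(3) unfolding gen_submodule_def by blast
  show "u \<oplus>\<^bsub>M\<^esub> v \<in> gen_submodule R M S"
    if "u \<in> gen_submodule R M S" "v \<in> gen_submodule R M S" for u v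
    using that submoduleE(5) unfolding gen_submodule_def by blast
  show "b \<odot>\<^bsub>M\<^esub> u \<in> gen_submodule R M S"
    if "b \<in> carrier R" "u \<in> gen_submodule R M S" for b u
    using that submoduleE(4) unfolding gen_submodule_def by blast
qed

text \<open>The chain is built recursively: the next generator is chosen so that its cyclic
  submodule contains the previous generator and the next element of an enumeration of
  \<open>S\<close>. The set \<open>G\<close> is \<open>carrier M\<close> in the local case and the
  set of homogeneous elements in the graded case.\<close>

lemma quasi_cyclic_byI:
  assumes G: "G \<subseteq> carrier M"
    and pair: "\<And>u v. u \<in> G \<Longrightarrow> v \<in> G \<Longrightarrow>
        \<exists>z\<in>G. u \<in> gen_submodule R M {z} \<and> v \<in> gen_submodule R M {z}"
    and S: "S \<subseteq> G" "countable S" "S \<noteq> {}" "gen_submodule R M S = carrier M"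
  shows "quasi_cyclic_by G R M"
proof -
  \<comment> \<open>Since \<open>S\<close> is nonempty, all values lie in \<open>S\<close>, even
    when \<open>S\<close> is finite and the enumeration repeats elements.\<close>
  define h where "h = from_nat_into S"
  have h: "h n \<in> G" for n using S(1) from_nat_into[OF S(3), of n] unfolding h_def by (rule subsetD)
  have "\<exists>z. \<forall>n. z n \<in> G \<and> (z n \<in> gen_submodule R M {z (Suc n)} \<and>
      h n \<in> gen_submodule R M {z (Suc n)})"
  proof (rule dependent_nat_choice)
    show "\<exists>z. z \<in> G" using h by (rule exI)
    show "\<exists>z'. z' \<in> G \<and> (z \<in> gen_submodule R M {z'} \<and> h n \<in> gen_submodule R M {z'})"
      if "z \<in> G" for z n using pair[OF that h] by blast
  qed
  then obtain z where "\<forall>n. z n \<in> G \<and> (z n \<in> gen_submodule R M {z (Suc n)} \<and>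
      h n \<in> gen_submodule R M {z (Suc n)})" by (rule exE)
  then have z: "\<And>n. z n \<in> G" "\<And>n. z n \<in> gen_submodule R M {z (Suc n)}"
    "\<And>n. h n \<in> gen_submodule R M {z (Suc n)}" by simp_all
  let ?N = "\<lambda>n. gen_submodule R M {z n}"
  have sub: "submodule (?N n) R M" for n
    using gen_submodule_is_submodule[of "{z n}"] z(1)[of n] G by auto
  have inc: "?N n \<subseteq> ?N (Suc n)" for n
    using gen_submodule_minimal[OF sub, of "{z n}" "Suc n"] z(2) by simp
  have U: "submodule (\<Union>n. ?N n) R M"
    using submodule_chain_Union[of ?N, OF sub inc] .
  have "S \<subseteq> (\<Union>n. ?N n)"
  proof
    fix s assume "s \<in> S"
    then obtain n where "s = h n" using from_nat_into_surj[OF S(2)] unfolding h_def by metis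
    then show "s \<in> (\<Union>n. ?N n)" using z(3)[of n] by (intro UN_I[of "Suc n"]) simp_all
  qed
  then have "carrier M \<subseteq> (\<Union>n. ?N n)"
    using gen_submodule_minimal[OF U, of S] S(4) by simp
  then have "carrier M = (\<Union>n. ?N n)"
    using submoduleE(1)[OF U] by (rule subset_antisym)
  moreover have "\<exists>w\<in>G. ?N n = gen_submodule R M {w}" for n
    using z(1)[of n] by (intro bexI[of _ "z n"]) simp_all
  ultimately show ?thesis
    unfolding quasi_cyclic_by_def using inc by (intro exI[of _ ?N]) simp
qed

end

section \<open>Graded modules\<close>

text \<open>The sum has a second decomposition, with the whole sum placed in degree \<open>d\<close>
  and zero elsewhere. Uniqueness identifies the two families.\<close>

lemma (in abelian_group) internal_direct_sum_component:
  assumes ds: "internal_direct_sum G D"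
    and c: "finite F" "\<And>i. c i \<in> D i" "\<And>i. i \<notin> F \<Longrightarrow> c i = \<zero>"
    and w: "(\<Oplus>i\<in>F. c i) \<in> D d"
  shows "c d = (\<Oplus>i\<in>F. c i)"
proof -
  let ?w = "\<Oplus>i\<in>F. c i"
  have sub: "subgroup (D i) (add_monoid G)" for i
    using ds unfolding internal_direct_sum_def by simp
  have carr: "x \<in> carrier G" if "x \<in> D i" for x i
    using subgroup.subset[OF sub] that by auto
  have zero: "\<zero> \<in> D i" for i
    using subgroup.one_closed[OF sub] by simp
  have supp: "{i. c i \<noteq> \<zero>} \<subseteq> F" using c(3) by auto
  \<comment> \<open>\<open>internal_direct_sum\<close> sums over the exact support, so
    \<open>F\<close> has to be shrunk to it before uniqueness applies.\<close>
  have "?w = (\<Oplus>i\<in>{i. c i \<noteq> \<zero>}. c i)"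
    using c(1,3) supp carr[OF c(2)]
    by (intro add.finprod_mono_neutral_cong_right) auto
  then have 1: "(\<forall>i. c i \<in> D i) \<and> finite {i. c i \<noteq> \<zero>} \<and> ?w = (\<Oplus>i\<in>{i. c i \<noteq> \<zero>}. c i)"
    using c(2) finite_subset[OF supp c(1)] by simp
  define c' where "c' = (\<lambda>i. if i = d then ?w else \<zero>)"
  have supp': "{i. c' i \<noteq> \<zero>} \<subseteq> {d}" unfolding c'_def by auto
  have "(\<Oplus>i\<in>{d}. c' i) = (\<Oplus>i\<in>{i. c' i \<noteq> \<zero>}. c' i)"
    using supp' carr[OF w]
    by (intro add.finprod_mono_neutral_cong_right) (auto simp: c'_def)
  moreover have "(\<Oplus>i\<in>{d}. c' i) = ?w"
    using carr[OF w] by (simp add: c'_def)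
  ultimately have 2: "(\<forall>i. c' i \<in> D i) \<and> finite {i. c' i \<noteq> \<zero>} \<and> ?w = (\<Oplus>i\<in>{i. c' i \<noteq> \<zero>}. c' i)"
    using zero w finite_subset[OF supp'] by (simp add: c'_def)
  have "\<exists>!c. (\<forall>i. c i \<in> D i) \<and> finite {i. c i \<noteq> \<zero>} \<and> ?w = (\<Oplus>i\<in>{i. c i \<noteq> \<zero>}. c i)"
    using ds carr[OF w] unfolding internal_direct_sum_def by simp
  then obtain c\<^sub>0 where "\<forall>c. (\<forall>i. c i \<in> D i) \<and> finite {i. c i \<noteq> \<zero>} \<and>
      ?w = (\<Oplus>i\<in>{i. c i \<noteq> \<zero>}. c i) \<longrightarrow> c = c\<^sub>0" by (rule ex1E)
  from this[rule_format, OF 1] this[rule_format, OF 2] have "c d = c' d" by simp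
  then show ?thesis by (simp add: c'_def)
qed

section \<open>Forms in a standard graded ring\<close>

text \<open>These turn out to be exactly the elements of \<open>A n\<close>, by
  \<open>form_deg\<close> and \<open>deg_form\<close>. The inductive presentation gives an induction
  that removes one linear factor at a time.\<close>

inductive form :: "('a, 'r) ring_scheme \<Rightarrow> (nat \<Rightarrow> 'a set) \<Rightarrow> nat \<Rightarrow> 'a \<Rightarrow> bool"
  for R (structure) and A where
  scalar: "a \<in> A 0 \<Longrightarrow> form R A 0 a"
| linear: "l \<in> A 1 \<Longrightarrow> form R A n f \<Longrightarrow> form R A (Suc n) (l \<otimes> f)"
| add: "form R A n f \<Longrightarrow> form R A n g \<Longrightarrow> form R A n (f \<oplus> g)"

inductive_set sums_of_forms :: "('a, 'r) ring_scheme \<Rightarrow> (nat \<Rightarrow> 'a set) \<Rightarrow> 'a set"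
  for R (structure) and A where
  form: "form R A n f \<Longrightarrow> f \<in> sums_of_forms R A"
| add: "f \<in> sums_of_forms R A \<Longrightarrow> g \<in> sums_of_forms R A \<Longrightarrow> f \<oplus> g \<in> sums_of_forms R A"

locale standard_graded = cring R for R (structure) +
  fixes A :: "nat \<Rightarrow> 'a set"
  assumes standard_graded: "standard_graded_ring R A"
begin

lemmas form_scalar = form.scalar[where R = R and A = A]
  and form_linear = form.linear[where R = R and A = A]

lemma direct_sum: "internal_direct_sum R A"
  and mult_deg: "a \<in> A i \<Longrightarrow> b \<in> A j \<Longrightarrow> a \<otimes> b \<in> A (i + j)"
  and scalars: "subfield (A 0) R"
  and generated: "carrier R = generate_ring R (A 0 \<union> A 1)"
  using standard_graded unfolding standard_graded_ring_def by simp_all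

lemma subgroup_deg: "subgroup (A i) (add_monoid R)"
  using direct_sum unfolding internal_direct_sum_def by simp

lemma deg_carrier: "a \<in> A i \<Longrightarrow> a \<in> carrier R"
  using subgroup.subset[OF subgroup_deg] by auto

lemma zero_deg: "\<zero> \<in> A i"
  using subgroup.one_closed[OF subgroup_deg] by simp

lemma add_deg: "a \<in> A i \<Longrightarrow> b \<in> A i \<Longrightarrow> a \<oplus> b \<in> A i"
  using subgroup.m_closed[OF subgroup_deg] by simp

lemma minus_deg: "a \<in> A i \<Longrightarrow> \<ominus> a \<in> A i"
  using subgroup.m_inv_closed[OF subgroup_deg] by (simp add: a_inv_def)

lemma one_deg: "\<one> \<in> A 0"
  using subringE(3)[OF subfieldE(1)[OF scalars]] .

lemma pow_deg: "a \<in> A i \<Longrightarrow> a [^] n \<in> A (n * i)"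
proof (induction n)
  case 0
  then show ?case by (simp add: one_deg)
next
  case (Suc n)
  then show ?case using mult_deg[of "a [^] n" "n * i" a i] by (simp add: add.commute)
qed

lemma form_deg: "form R A n f \<Longrightarrow> f \<in> A n"
proof (induction rule: form.induct)
  case (linear l n f)
  then show ?case using mult_deg[of l 1 f n] by simp
qed (auto intro: add_deg)

lemma form_carrier: "form R A n f \<Longrightarrow> f \<in> carrier R"
  by (rule deg_carrier[OF form_deg])

lemma form_zero: "form R A n \<zero>"
proof (induction n)
  case 0
  show ?case by (rule form_scalar[OF zero_deg])
next
  case (Suc n)
  then show ?case using form_linear[OF zero_deg Suc] by simp
qed

lemma form_minus: "form R A n f \<Longrightarrow> form R A n (\<ominus> f)"
proof (induction rule: form.induct)
  case (scalar a)
  then show ?case by (intro form_scalar minus_deg)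
next
  case (linear l n f)
  then show ?case
    using form_linear[OF linear(1,3)] deg_carrier form_carrier by (simp add: r_minus)
next
  case (add n f g)
  then show ?case
    using form.add[OF add(3,4)] form_carrier by (simp add: minus_add)
qed

lemma form_mult:
  assumes "form R A n f" "form R A m g"
  shows "form R A (n + m) (f \<otimes> g)"
  using assms(1)
proof (induction rule: form.induct)
  case (scalar a)
  \<comment> \<open>A second induction, on \<open>g\<close>, carries the scalar past the linear
    factors of \<open>g\<close> until it meets another scalar.\<close>
  show ?case using assms(2) scalar
  proof (induction rule: form.induct)
    case (scalar b)
    then show ?case using mult_deg[of a 0 b 0] by (simp add: form_scalar)
  next
    case (linear l n f)
    then have "a \<otimes> (l \<otimes> f) = l \<otimes> (a \<otimes> f)"
      using deg_carrier form_carrier m_lcomm by simp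
    then show ?case using form_linear[OF linear(1)] linear by simp
  next
    case (add n f g)
    then have "a \<otimes> (f \<oplus> g) = a \<otimes> f \<oplus> a \<otimes> g"
      using deg_carrier form_carrier r_distr by simp
    then show ?case using form.add add by simp
  qed
next
  case (linear l n f)
  then have "l \<otimes> f \<otimes> g = l \<otimes> (f \<otimes> g)"
    using deg_carrier form_carrier assms(2) m_assoc by simp
  then show ?case using form_linear[OF linear(1,3)] by simp
next
  case (add n f f')
  then have "(f \<oplus> f') \<otimes> g = f \<otimes> g \<oplus> f' \<otimes> g"
    using form_carrier assms(2) l_distr by simp
  then show ?case using form.add[OF add(3,4)] by simp
qed

lemma sums_of_forms_carrier: "f \<in> sums_of_forms R A \<Longrightarrow> f \<in> carrier R"
  by (induction rule: sums_of_forms.induct) (simp_all add: form_carrier)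

lemma sums_of_forms_minus: "f \<in> sums_of_forms R A \<Longrightarrow> \<ominus> f \<in> sums_of_forms R A"
proof (induction rule: sums_of_forms.induct)
  case (form n f)
  then show ?case by (rule sums_of_forms.form[OF form_minus])
next
  case (add f g)
  then show ?case
    using sums_of_forms.add[OF add(3,4)] sums_of_forms_carrier by (simp add: minus_add)
qed

lemma sums_of_forms_mult:
  assumes "f \<in> sums_of_forms R A" "g \<in> sums_of_forms R A"
  shows "f \<otimes> g \<in> sums_of_forms R A"
  using assms(1)
proof (induction rule: sums_of_forms.induct)
  case f: (form n f)
  show ?case using assms(2)
  proof (induction rule: sums_of_forms.induct)
    case (form m g)
    then show ?case by (rule sums_of_forms.form[OF form_mult[OF f]])
  next
    case (add g g')
    then show ?case
      using sums_of_forms.add[OF add(3,4)] sums_of_forms_carrier form_carrier[OF f]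
      by (simp add: r_distr)
  qed
next
  case (add f f')
  then show ?case
    using sums_of_forms.add[OF add(3,4)] sums_of_forms_carrier assms(2)
    by (simp add: l_distr)
qed

text \<open>Sums of forms contain \<open>A 0\<close> and \<open>A 1\<close> and are closed under the
  ring operations, so generation in degree one makes them the whole ring.\<close>

lemma carrier_sums_of_forms:
  assumes "f \<in> carrier R"
  shows "f \<in> sums_of_forms R A"
proof -
  have "f \<in> generate_ring R (A 0 \<union> A 1)" using assms generated by simp
  then show ?thesis
  proof (induction rule: generate_ring.induct)
    case one
    show ?case by (rule sums_of_forms.form[OF form_scalar[OF one_deg]])
  next
    case (incl h)
    then show ?case
    proof
      assume "h \<in> A 1"
      from form_linear[OF this form_scalar[OF one_deg]] show ?thesis
        using deg_carrier[OF \<open>h \<in> A 1\<close>] sums_of_forms.form by simp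
    qed (rule sums_of_forms.form[OF form_scalar])
  qed (auto intro: sums_of_forms.add sums_of_forms_minus sums_of_forms_mult)
qed

text \<open>Terms of equal degree are collected into one form. The default value zero outside
  \<open>F\<close> is itself a form of every degree, so two families can be added over the union of
  their index sets.\<close>

lemma sums_of_forms_decomp:
  "f \<in> sums_of_forms R A \<Longrightarrow>
    \<exists>c F. finite F \<and> (\<forall>n. form R A n (c n)) \<and> (\<forall>n. n \<notin> F \<longrightarrow> c n = \<zero>) \<and> f = (\<Oplus>n\<in>F. c n)"
proof (induction rule: sums_of_forms.induct)
  case (form n f)
  let ?c = "\<lambda>i. if i = n then f else \<zero>"
  have "(\<Oplus>i\<in>{n}. ?c i) = f" using form_carrier[OF form] by simp
  then show ?case using form form_zero
    by (intro exI[of _ ?c] exI[of _ "{n}"]) simp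
next
  case (add f g)
  from add(3) obtain c F where "finite F \<and> (\<forall>n. form R A n (c n)) \<and>
      (\<forall>n. n \<notin> F \<longrightarrow> c n = \<zero>) \<and> f = (\<Oplus>n\<in>F. c n)" by (elim exE)
  then have c: "finite F" "\<And>n. form R A n (c n)" "\<And>n. n \<notin> F \<Longrightarrow> c n = \<zero>"
    "f = (\<Oplus>n\<in>F. c n)" by simp_all
  from add(4) obtain c' F' where "finite F' \<and> (\<forall>n. form R A n (c' n)) \<and>
      (\<forall>n. n \<notin> F' \<longrightarrow> c' n = \<zero>) \<and> g = (\<Oplus>n\<in>F'. c' n)" by (elim exE)
  then have c': "finite F'" "\<And>n. form R A n (c' n)" "\<And>n. n \<notin> F' \<Longrightarrow> c' n = \<zero>"
    "g = (\<Oplus>n\<in>F'. c' n)" by simp_all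
  have "f = (\<Oplus>n\<in>F \<union> F'. c n)"
    unfolding c(4) using c(1,3) c'(1) form_carrier[OF c(2)]
    by (intro add.finprod_mono_neutral_cong_left) auto
  moreover have "g = (\<Oplus>n\<in>F \<union> F'. c' n)"
    unfolding c'(4) using c'(1,3) c(1) form_carrier[OF c'(2)]
    by (intro add.finprod_mono_neutral_cong_left) auto
  ultimately have "f \<oplus> g = (\<Oplus>n\<in>F \<union> F'. c n \<oplus> c' n)"
    using form_carrier[OF c(2)] form_carrier[OF c'(2)] by (simp add: add.finprod_multf)
  then show ?case using c(1,3,4) c'(1,3,4) form.add[OF c(2) c'(2)]
    by (intro exI[of _ "\<lambda>n. c n \<oplus> c' n"] exI[of _ "F \<union> F'"]) simp
qed

text \<open>Split \<open>f\<close> into forms of different degrees. As \<open>f\<close> is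
  homogeneous of degree \<open>n\<close>, it equals its component of that degree.\<close>

lemma deg_form:
  assumes "f \<in> A n"
  shows "form R A n f"
proof -
  from sums_of_forms_decomp[OF carrier_sums_of_forms[OF deg_carrier[OF assms]]]
  obtain c F where "finite F \<and> (\<forall>n. form R A n (c n)) \<and> (\<forall>n. n \<notin> F \<longrightarrow> c n = \<zero>) \<and>
    f = (\<Oplus>n\<in>F. c n)" by (elim exE)
  then have c: "finite F" "\<And>n. form R A n (c n)" "\<And>n. n \<notin> F \<Longrightarrow> c n = \<zero>"
    and f: "f = (\<Oplus>n\<in>F. c n)" by simp_all
  have "c n = (\<Oplus>n\<in>F. c n)"
    using internal_direct_sum_component[OF direct_sum c(1) form_deg[OF c(2)] c(3)] assms f by simp
  then show ?thesis using c(2)[of n] f by simp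
qed

end

section \<open>Homogeneous components and generators of graded modules\<close>

locale standard_graded_module = module R M + standard_graded R A
  for R (structure) and M (structure) and A +
  fixes D :: "int \<Rightarrow> 'c set"
  assumes graded_module: "graded_module R A M D"
begin

lemma mdirect_sum: "internal_direct_sum M D"
  and smult_deg: "a \<in> A i \<Longrightarrow> m \<in> D j \<Longrightarrow> a \<odot>\<^bsub>M\<^esub> m \<in> D (int i + j)"
  using graded_module unfolding graded_module_def by simp_all

lemma subgroup_mdeg: "subgroup (D i) (add_monoid M)"
  using mdirect_sum unfolding internal_direct_sum_def by simp

lemma mdeg_carrier: "m \<in> D i \<Longrightarrow> m \<in> carrier M"
  using subgroup.subset[OF subgroup_mdeg] by auto

lemma zero_mdeg: "\<zero>\<^bsub>M\<^esub> \<in> D i"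
  using subgroup.one_closed[OF subgroup_mdeg] by simp

lemma mdecomp:
  assumes "m \<in> carrier M"
  shows "\<exists>c F. finite F \<and> (\<forall>i. c i \<in> D i) \<and> (\<forall>i. i \<notin> F \<longrightarrow> c i = \<zero>\<^bsub>M\<^esub>) \<and>
    m = (\<Oplus>\<^bsub>M\<^esub>i\<in>F. c i)"
proof -
  have "\<exists>!c. (\<forall>i. c i \<in> D i) \<and> finite {i. c i \<noteq> \<zero>\<^bsub>M\<^esub>} \<and>
      m = (\<Oplus>\<^bsub>M\<^esub>i\<in>{i. c i \<noteq> \<zero>\<^bsub>M\<^esub>}. c i)"
    using mdirect_sum assms unfolding internal_direct_sum_def by simp
  from ex1_implies_ex[OF this] obtain c where "(\<forall>i. c i \<in> D i) \<and> finite {i. c i \<noteq> \<zero>\<^bsub>M\<^esub>} \<and>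
      m = (\<Oplus>\<^bsub>M\<^esub>i\<in>{i. c i \<noteq> \<zero>\<^bsub>M\<^esub>}. c i)" by (rule exE)
  then show ?thesis by (intro exI[of _ c] exI[of _ "{i. c i \<noteq> \<zero>\<^bsub>M\<^esub>}"]) simp
qed

text \<open>Here \<open>c\<close> is the family of homogeneous components of \<open>m\<close>;
  compare components of degree \<open>d\<close> in the product. One family serves all
  \<open>x\<close>, \<open>a\<close> and \<open>d\<close>, so two equations for \<open>m\<close>
  that single out the same degree are solved by the same component.\<close>

lemma homogeneous_solution:
  assumes m: "m \<in> carrier M"
  obtains c where "\<And>i. c i \<in> D i"
    "\<And>a x d. x \<in> A a \<Longrightarrow> x \<odot>\<^bsub>M\<^esub> m \<in> D d \<Longrightarrow> x \<odot>\<^bsub>M\<^esub> c (d - int a) = x \<odot>\<^bsub>M\<^esub> m"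
proof -
  from mdecomp[OF m] obtain c F where "finite F \<and> (\<forall>i. c i \<in> D i) \<and>
    (\<forall>i. i \<notin> F \<longrightarrow> c i = \<zero>\<^bsub>M\<^esub>) \<and> m = (\<Oplus>\<^bsub>M\<^esub>i\<in>F. c i)" by (elim exE)
  then have c: "finite F" "\<And>i. c i \<in> D i" "\<And>i. i \<notin> F \<Longrightarrow> c i = \<zero>\<^bsub>M\<^esub>"
    and m_eq: "m = (\<Oplus>\<^bsub>M\<^esub>i\<in>F. c i)" by simp_all
  have "x \<odot>\<^bsub>M\<^esub> c (d - int a) = x \<odot>\<^bsub>M\<^esub> m" if x: "x \<in> A a" "x \<odot>\<^bsub>M\<^esub> m \<in> D d" for a x d
  proof -
    note xR = deg_carrier[OF x(1)]
    note cM = mdeg_carrier[OF c(2)]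
    \<comment> \<open>Multiplication by \<open>x\<close> shifts degrees by \<open>a\<close>, so the
      components of the product are reindexed by their new degree.\<close>
    let ?c = "\<lambda>j. x \<odot>\<^bsub>M\<^esub> c (j - int a)" and ?F = "(\<lambda>i. i + int a) ` F"
    have "x \<odot>\<^bsub>M\<^esub> m = (\<Oplus>\<^bsub>M\<^esub>i\<in>F. x \<odot>\<^bsub>M\<^esub> c i)"
      unfolding m_eq using c(1) xR cM by (intro finsum_smult_ldistr) auto
    also have "\<dots> = (\<Oplus>\<^bsub>M\<^esub>j\<in>?F. ?c j)"
      using xR cM by (subst M.finsum_reindex) (auto simp: inj_on_def)
    finally have eq: "x \<odot>\<^bsub>M\<^esub> m = (\<Oplus>\<^bsub>M\<^esub>j\<in>?F. ?c j)" .
    have "?c d = (\<Oplus>\<^bsub>M\<^esub>j\<in>?F. ?c j)"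
    proof (rule M.internal_direct_sum_component[OF mdirect_sum])
      show "finite ?F" using c(1) by simp
      show "?c j \<in> D j" for j using smult_deg[OF x(1) c(2)[of "j - int a"]] by simp
      show "?c j = \<zero>\<^bsub>M\<^esub>" if "j \<notin> ?F" for j
      proof -
        have "j - int a \<notin> F" using that by (auto simp: image_iff)
        then show ?thesis using c(3) xR by simp
      qed
      show "(\<Oplus>\<^bsub>M\<^esub>j\<in>?F. ?c j) \<in> D d" using x(2) eq by simp
    qed
    then show ?thesis using eq by simp
  qed
  then show thesis using that c(2) by blast
qed

lemma homogeneous_generators:
  assumes "countably_generated R M"
  obtains S where "S \<subseteq> homogeneous D" "countable S" "S \<noteq> {}" "gen_submodule R M S = carrier M"
proof -
  obtain T where T: "T \<subseteq> carrier M" "countable T" "gen_submodule R M T = carrier M"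
    using assms unfolding countably_generated_def by blast
  have "\<forall>m\<in>carrier M. \<exists>c. (\<forall>i. c i \<in> D i) \<and> (\<exists>F. finite F \<and> m = (\<Oplus>\<^bsub>M\<^esub>i\<in>F. c i))"
    using mdecomp by fast
  from bchoice[OF this] obtain c where
    "\<forall>m\<in>carrier M. (\<forall>i. c m i \<in> D i) \<and> (\<exists>F. finite F \<and> m = (\<Oplus>\<^bsub>M\<^esub>i\<in>F. c m i))"
    by (rule exE)
  then have c: "\<And>m i. m \<in> carrier M \<Longrightarrow> c m i \<in> D i"
    "\<And>m. m \<in> carrier M \<Longrightarrow> \<exists>F. finite F \<and> m = (\<Oplus>\<^bsub>M\<^esub>i\<in>F. c m i)" by simp_all
  \<comment> \<open>All components of the given generators; zero is inserted so that
    \<open>S\<close> is nonempty, as an enumeration requires.\<close>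
  define S where "S = insert \<zero>\<^bsub>M\<^esub> (\<Union>t\<in>T. range (c t))"
  have S: "S \<subseteq> homogeneous D"
    unfolding S_def homogeneous_def using c(1) T(1) zero_mdeg by blast
  then have SM: "S \<subseteq> carrier M" unfolding homogeneous_def using mdeg_carrier by blast
  have sub: "submodule (gen_submodule R M S) R M" using gen_submodule_is_submodule[OF SM] .
  have self: "S \<subseteq> gen_submodule R M S" unfolding gen_submodule_def by blast
  have sum: "(\<Oplus>\<^bsub>M\<^esub>i\<in>E. c t i) \<in> gen_submodule R M S" if "finite E" "t \<in> T" for E t
    using that(1)
  proof induction
    case empty
    then show ?case using subgroup.one_closed[OF submodule.axioms(1)[OF sub]] by simp
  next
    case (insert i E)
    have "c t i \<in> gen_submodule R M S" using self that(2) unfolding S_def by blast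
    moreover have "c t j \<in> carrier M" for j using mdeg_carrier[OF c(1)] T(1) that(2) by blast
    ultimately show ?case using insert submoduleE(5)[OF sub] by simp
  qed
  have "T \<subseteq> gen_submodule R M S"
  proof
    fix t assume t: "t \<in> T"
    then have tM: "t \<in> carrier M" using T(1) by auto
    from c(2)[OF tM] obtain F where F: "finite F" "t = (\<Oplus>\<^bsub>M\<^esub>i\<in>F. c t i)" by (elim exE conjE)
    from sum[OF F(1) t] show "t \<in> gen_submodule R M S" using F(2) by simp
  qed
  then have "carrier M \<subseteq> gen_submodule R M S"
    using gen_submodule_minimal[OF sub, of T] T(3) by simp
  then have "gen_submodule R M S = carrier M"
    using submoduleE(1)[OF sub] by simp
  moreover have "countable S" unfolding S_def using T(2) by auto
  ultimately show thesis using that[OF S] unfolding S_def by simp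
qed

text \<open>A nonzero scalar is a unit and acts injectively, so none of its powers can kill
  \<open>m\<close>. This will force the members of a coregular pair to have positive degree.\<close>

lemma scalar_locally_nilpotent_zero:
  assumes k: "k \<in> A 0" and m: "m \<in> carrier M" "m \<noteq> \<zero>\<^bsub>M\<^esub>" and "k [^] (n::nat) \<odot>\<^bsub>M\<^esub> m = \<zero>\<^bsub>M\<^esub>"
  shows "k = \<zero>"
proof (rule ccontr)
  assume "k \<noteq> \<zero>"
  then have k0: "k \<in> A 0 - {\<zero>}" using k by simp
  have inv: "inv k \<in> carrier R" "inv k \<otimes> k = \<one>"
    using R.subfield_m_inv[OF scalars k0] deg_carrier by auto
  have kR: "k \<in> carrier R" using k deg_carrier by simp
  have inj: "m' = \<zero>\<^bsub>M\<^esub>" if "m' \<in> carrier M" "k \<odot>\<^bsub>M\<^esub> m' = \<zero>\<^bsub>M\<^esub>" for m'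
  proof -
    have "m' = inv k \<odot>\<^bsub>M\<^esub> (k \<odot>\<^bsub>M\<^esub> m')"
      using inv kR that(1) smult_assoc1[OF inv(1) kR that(1)] by simp
    then show ?thesis using that inv by simp
  qed
  have "k [^] n \<odot>\<^bsub>M\<^esub> m \<noteq> \<zero>\<^bsub>M\<^esub>" for n :: nat
  proof (induction n)
    case 0
    then show ?case using m by simp
  next
    case (Suc n)
    then show ?case using inj[of "k [^] n \<odot>\<^bsub>M\<^esub> m"] smult_pow_Suc2[OF kR m(1)] kR m(1) by auto
  qed
  then show False using assms(4) by simp
qed

end

section \<open>Two homogeneous elements in one cyclic submodule\<close>

locale graded_coregular_pair = standard_graded_module +
  fixes x y a b
  assumes x: "x \<in> A a" and y: "y \<in> A b" and pos: "0 < a" "0 < b"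
    and surj: "m \<in> carrier M \<Longrightarrow> \<exists>m'\<in>carrier M. x \<odot>\<^bsub>M\<^esub> m' = m"
    and ker: "t \<in> carrier M \<Longrightarrow> x \<odot>\<^bsub>M\<^esub> t = \<zero>\<^bsub>M\<^esub> \<Longrightarrow>
        \<exists>s\<in>carrier M. x \<odot>\<^bsub>M\<^esub> s = \<zero>\<^bsub>M\<^esub> \<and> y \<odot>\<^bsub>M\<^esub> s = t"
    and nil: "m \<in> carrier M \<Longrightarrow> \<exists>n::nat. x [^] n \<odot>\<^bsub>M\<^esub> m = \<zero>\<^bsub>M\<^esub>"
      "m \<in> carrier M \<Longrightarrow> \<exists>n::nat. y [^] n \<odot>\<^bsub>M\<^esub> m = \<zero>\<^bsub>M\<^esub>"
begin

text \<open>A homogeneous \<open>z\<close> with x^n z = u and y^m z = v needs d - n a = e - m b. For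
  n = b p and m = a q this reads d - e = a b (p - q), which is solvable by the congruence. The
  degree of \<open>z\<close> stays in the class of \<open>d\<close>, so the construction can be
  iterated.\<close>

lemma congruent_degrees_cyclic:
  assumes u: "u \<in> D d" and v: "v \<in> D e" and de: "int (a * b) dvd d - e"
  shows "\<exists>j. \<exists>z\<in>D j. int (a * b) dvd d - j \<and>
    u \<in> gen_submodule R M {z} \<and> v \<in> gen_submodule R M {z}"
proof -
  note xy = deg_carrier[OF x] deg_carrier[OF y]
  note uv = mdeg_carrier[OF u] mdeg_carrier[OF v]
  obtain k where k: "d - e = int (a * b) * k" using de by (elim dvdE)
  obtain n1 n2 :: nat where "y [^] n1 \<odot>\<^bsub>M\<^esub> u = \<zero>\<^bsub>M\<^esub>" "x [^] n2 \<odot>\<^bsub>M\<^esub> v = \<zero>\<^bsub>M\<^esub>"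
    using nil uv by blast
  note nil' = pow_smult_zero_mono[OF xy(2) uv(1) this(1)] pow_smult_zero_mono[OF xy(1) uv(2) this(2)]
  \<comment> \<open>The summand \<open>n1 + n2\<close> makes both exponents large enough to
    annihilate, and \<open>nat k\<close> and \<open>nat (- k)\<close> adjust the difference p - q to
    \<open>k\<close> whatever its sign.\<close>
  define p where "p = n1 + n2 + nat k"
  define q where "q = n1 + n2 + nat (- k)"
  have "n2 \<le> b * p" "n1 \<le> a * q"
    using pos mult_le_mono[of 1 b n2 p] mult_le_mono[of 1 a n1 q] by (simp_all add: p_def q_def)
  then have "y [^] (a * q) \<odot>\<^bsub>M\<^esub> u = x [^] (b * p) \<odot>\<^bsub>M\<^esub> v"
    using nil' by simp
  from koszul_exact[OF xy surj ker uv this] obtain z where z: "z \<in> carrier M"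
    "x [^] (b * p) \<odot>\<^bsub>M\<^esub> z = u" "y [^] (a * q) \<odot>\<^bsub>M\<^esub> z = v" by blast
  obtain c where c: "\<And>i. c i \<in> D i"
    "\<And>a x d. x \<in> A a \<Longrightarrow> x \<odot>\<^bsub>M\<^esub> z \<in> D d \<Longrightarrow> x \<odot>\<^bsub>M\<^esub> c (d - int a) = x \<odot>\<^bsub>M\<^esub> z"
    using homogeneous_solution[OF z(1)] by blast
  \<comment> \<open>The \<open>z\<close> found so far need not be homogeneous. Both equations single
    out the same degree \<open>j\<close>, so its component \<open>c j\<close> satisfies them
    both.\<close>
  define j where "j = d - int (b * p * a)"
  have "int p - int q = k" unfolding p_def q_def by simp
  then have "d - e = int (a * b) * (int p - int q)" using k by simp
  then have j: "j = e - int (a * q * b)" unfolding j_def by (simp add: algebra_simps)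
  have "x [^] (b * p) \<odot>\<^bsub>M\<^esub> c j = u"
    using c(2)[OF pow_deg[OF x, of "b * p"]] z(2) u unfolding j_def by simp
  moreover have "y [^] (a * q) \<odot>\<^bsub>M\<^esub> c j = v"
    using c(2)[OF pow_deg[OF y, of "a * q"]] z(3) v unfolding j by simp
  moreover have "gen_submodule R M {c j} = {r \<odot>\<^bsub>M\<^esub> c j | r. r \<in> carrier R}"
    using gen_submodule_singleton[OF mdeg_carrier[OF c(1)]] .
  ultimately have "u \<in> gen_submodule R M {c j}" "v \<in> gen_submodule R M {c j}"
    using xy R.nat_pow_closed by auto
  moreover have "int (a * b) dvd d - j" unfolding j_def by simp
  ultimately show ?thesis using c(1) by blast
qed

text \<open>The element \<open>w\<close> may be inhomogeneous. Quantifying over all \<open>u\<close>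
  and keeping the new generator in the class of \<open>d\<close> make the property stable under
  sums, which is what decomposing a form requires.\<close>

definition cyclic_with :: "int \<Rightarrow> 'c \<Rightarrow> bool" where
  "cyclic_with d w \<longleftrightarrow> (\<forall>e. \<forall>u\<in>D e. int (a * b) dvd d - e \<longrightarrow>
     (\<exists>j. \<exists>z\<in>D j. int (a * b) dvd d - j \<and>
        u \<in> gen_submodule R M {z} \<and> w \<in> gen_submodule R M {z}))"

lemma cyclic_with_deg:
  assumes w: "w \<in> D e" and e: "int (a * b) dvd d - e"
  shows "cyclic_with d w"
  unfolding cyclic_with_def
proof (intro allI ballI impI)
  fix e' u assume u: "u \<in> D e'" and e': "int (a * b) dvd d - e'"
  have "int (a * b) dvd e' - e" using dvd_diff[OF e e'] by simp
  from congruent_degrees_cyclic[OF u w this] obtain j z where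
    z: "z \<in> D j" "int (a * b) dvd e' - j" "u \<in> gen_submodule R M {z}" "w \<in> gen_submodule R M {z}"
    by blast
  moreover have "int (a * b) dvd d - j" using dvd_add[OF e' z(2)] by simp
  ultimately show "\<exists>j. \<exists>z\<in>D j. int (a * b) dvd d - j \<and>
        u \<in> gen_submodule R M {z} \<and> w \<in> gen_submodule R M {z}" by blast
qed

lemma cyclic_submodule: "z \<in> D j \<Longrightarrow> submodule (gen_submodule R M {z}) R M"
  using gen_submodule_is_submodule[of "{z}"] mdeg_carrier by simp

lemma cyclic_with_smult:
  assumes "cyclic_with d w" "r \<in> carrier R"
  shows "cyclic_with d (r \<odot>\<^bsub>M\<^esub> w)"
  unfolding cyclic_with_def
proof (intro allI ballI impI)
  fix e u assume "u \<in> D e" "int (a * b) dvd d - e"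
  then obtain j z where z: "z \<in> D j" "int (a * b) dvd d - j"
    "u \<in> gen_submodule R M {z}" "w \<in> gen_submodule R M {z}"
    using assms(1) unfolding cyclic_with_def by blast
  have "r \<odot>\<^bsub>M\<^esub> w \<in> gen_submodule R M {z}"
    using submoduleE(4)[OF cyclic_submodule[OF z(1)] assms(2) z(4)] .
  with z show "\<exists>j. \<exists>z\<in>D j. int (a * b) dvd d - j \<and>
        u \<in> gen_submodule R M {z} \<and> r \<odot>\<^bsub>M\<^esub> w \<in> gen_submodule R M {z}" by blast
qed

lemma cyclic_with_add:
  assumes "cyclic_with d w" "cyclic_with d w'"
  shows "cyclic_with d (w \<oplus>\<^bsub>M\<^esub> w')"
  unfolding cyclic_with_def
proof (intro allI ballI impI)
  fix e u assume "u \<in> D e" "int (a * b) dvd d - e"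
  then obtain j z where z: "z \<in> D j" "int (a * b) dvd d - j"
    "u \<in> gen_submodule R M {z}" "w \<in> gen_submodule R M {z}"
    using assms(1) unfolding cyclic_with_def by blast
  \<comment> \<open>The generator \<open>z\<close> found for \<open>w\<close> takes the place of
    \<open>u\<close> when \<open>w'\<close> is absorbed.\<close>
  then obtain j' z' where z': "z' \<in> D j'" "int (a * b) dvd d - j'"
    "z \<in> gen_submodule R M {z'}" "w' \<in> gen_submodule R M {z'}"
    using assms(2) unfolding cyclic_with_def by blast
  have "gen_submodule R M {z} \<subseteq> gen_submodule R M {z'}"
    using gen_submodule_minimal[OF cyclic_submodule[OF z'(1)]] z'(3) by simp
  then have "u \<in> gen_submodule R M {z'}" "w \<in> gen_submodule R M {z'}"
    using z(3,4) by auto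
  moreover from this(2) have "w \<oplus>\<^bsub>M\<^esub> w' \<in> gen_submodule R M {z'}"
    using submoduleE(5)[OF cyclic_submodule[OF z'(1)] _ z'(4)] by simp
  ultimately show "\<exists>j. \<exists>z\<in>D j. int (a * b) dvd d - j \<and>
        u \<in> gen_submodule R M {z} \<and> w \<oplus>\<^bsub>M\<^esub> w' \<in> gen_submodule R M {z}"
    using z'(1,2) by blast
qed

text \<open>Multiplying \<open>v\<close> by linear factors of \<open>f\<close> one at a time, the degree passes through the residue
  class of \<open>d\<close> after \<open>i\<close> steps.\<close>

lemma form_cyclic_with:
  assumes "form R A n f" "v \<in> D e" "i \<le> n" "int (a * b) dvd d - (e + int i)"
  shows "cyclic_with d (f \<odot>\<^bsub>M\<^esub> v)"
  using assms
proof (induction arbitrary: v e i rule: form.induct)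
  case (scalar r)
  then show ?case
    using cyclic_with_smult[OF cyclic_with_deg[of v e d] deg_carrier[OF scalar(1)]] by simp
next
  case (linear l n f)
  note fl = deg_carrier[OF linear(1)] form_carrier[OF linear(2)]
  note vM = mdeg_carrier[OF linear(4)]
  show ?case
  proof (cases i)
    case 0
    then show ?thesis
      \<comment> \<open>Now \<open>v\<close> is already in the class of \<open>d\<close>, and the
        remaining factor acts as an arbitrary ring element.\<close>
      using cyclic_with_smult[OF cyclic_with_deg[of v e d], of "l \<otimes> f"] linear(4,6) fl by simp
  next
    case (Suc i')
    \<comment> \<open>The factor \<open>l\<close> moves onto \<open>v\<close>: the degree rises by
      one and one step fewer remains.\<close>
    have "(l \<otimes> f) \<odot>\<^bsub>M\<^esub> v = f \<odot>\<^bsub>M\<^esub> (l \<odot>\<^bsub>M\<^esub> v)"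
      using fl vM smult_assoc1[OF fl vM] smult_commute[OF fl vM] by simp
    moreover have "l \<odot>\<^bsub>M\<^esub> v \<in> D (1 + e)"
      using smult_deg[OF linear(1,4)] by simp
    moreover have "int (a * b) dvd d - ((1 + e) + int i')"
      using linear(6) Suc by (simp add: algebra_simps)
    ultimately show ?thesis
      using linear(3)[of "l \<odot>\<^bsub>M\<^esub> v" "1 + e" i'] linear(5) Suc by simp
  qed
next
  case (add n f g)
  note fg = form_carrier[OF add(1)] form_carrier[OF add(2)]
  have "(f \<oplus> g) \<odot>\<^bsub>M\<^esub> v = f \<odot>\<^bsub>M\<^esub> v \<oplus>\<^bsub>M\<^esub> g \<odot>\<^bsub>M\<^esub> v"
    using smult_l_distr[OF fg mdeg_carrier[OF add(5)]] .
  then show ?case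
    using cyclic_with_add[OF add(3)[OF add(5-7)] add(4)[OF add(5-7)]] by simp
qed

text \<open>Write \<open>v\<close> as x^(ab) times a homogeneous element. The form x^(ab) has degree
  at least a b, so its linear factors suffice to carry that element into the residue class of
  \<open>d\<close> modulo a b.\<close>

lemma homogeneous_cyclic:
  assumes "u \<in> homogeneous D" "v \<in> homogeneous D"
  shows "\<exists>z\<in>homogeneous D. u \<in> gen_submodule R M {z} \<and> v \<in> gen_submodule R M {z}"
proof -
  obtain d e where u: "u \<in> D d" and v: "v \<in> D e"
    using assms unfolding homogeneous_def by blast
  let ?N = "a * b"
  note xR = deg_carrier[OF x]
  obtain w where w: "w \<in> carrier M" "x [^] ?N \<odot>\<^bsub>M\<^esub> w = v"
    using pow_smult_surj[OF xR subset_refl surj mdeg_carrier[OF v]] by blast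
  define e' where "e' = e - int (?N * a)"
  obtain c where c: "\<And>i. c i \<in> D i"
    "\<And>a x d. x \<in> A a \<Longrightarrow> x \<odot>\<^bsub>M\<^esub> w \<in> D d \<Longrightarrow> x \<odot>\<^bsub>M\<^esub> c (d - int a) = x \<odot>\<^bsub>M\<^esub> w"
    using homogeneous_solution[OF w(1)] by blast
  have v': "x [^] ?N \<odot>\<^bsub>M\<^esub> c e' = v"
    using c(2)[OF pow_deg[OF x, of ?N]] w(2) v unfolding e'_def by simp
  \<comment> \<open>The number of linear factors after which degree e' + i is congruent to
    \<open>d\<close>; it is below a b and so does not exceed the degree of x^(ab).\<close>
  define i where "i = nat ((d - e') mod int ?N)"
  have N: "0 < int ?N" using pos by simp
  then have i: "int i = (d - e') mod int ?N" unfolding i_def by simp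
  also have "\<dots> < int ?N" using N by (rule pos_mod_bound)
  finally have "i \<le> ?N" by linarith
  also have "\<dots> \<le> ?N * a" using pos by simp
  finally have "i \<le> ?N * a" .
  moreover have "int ?N dvd d - (e' + int i)"
  proof -
    have "int ?N dvd (d - e') - (d - e') mod int ?N" by (rule dvd_minus_mod)
    then show ?thesis unfolding i by (simp only: diff_diff_eq)
  qed
  ultimately have "cyclic_with d (x [^] ?N \<odot>\<^bsub>M\<^esub> c e')"
    by (rule form_cyclic_with[OF deg_form[OF pow_deg[OF x]] c(1)])
  then have "cyclic_with d v" by (simp only: v')
  from this[unfolded cyclic_with_def, rule_format, OF u] have
    "\<exists>j. \<exists>z\<in>D j. int ?N dvd d - j \<and>
      u \<in> gen_submodule R M {z} \<and> v \<in> gen_submodule R M {z}" by simp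
  then obtain j z where "z \<in> D j" "u \<in> gen_submodule R M {z}" "v \<in> gen_submodule R M {z}"
    by blast
  then show ?thesis unfolding homogeneous_def by blast
qed

end

section \<open>Coregular sequences of length two\<close>

lemma two_le_SUP_length:
  assumes "2 \<le> (SUP xs\<in>S. enat (length xs))"
  obtains xs where "xs \<in> S" "2 \<le> length xs"
proof -
  have "\<exists>xs\<in>S. 2 \<le> length xs"
  proof (rule ccontr)
    assume "\<not> (\<exists>xs\<in>S. 2 \<le> length xs)"
    then have "length xs \<le> 1" if "xs \<in> S" for xs using that by fastforce
    then have "(SUP xs\<in>S. enat (length xs)) \<le> 1"
      by (intro SUP_least) (simp add: one_enat_def)
    with assms have "(2::enat) \<le> 1" by (rule order_trans)
    then show False by (simp add: numeral_eq_enat one_enat_def)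
  qed
  then show thesis using that by blast
qed

text \<open>Elementwise form of the first two coregularity conditions, as
  \<open>koszul_exact\<close> takes them; any later entries of the sequence are ignored.\<close>

lemma coregular_pair:
  assumes "coregular M xs" "2 \<le> length xs"
  shows "\<And>m. m \<in> carrier M \<Longrightarrow> \<exists>m'\<in>carrier M. xs ! 0 \<odot>\<^bsub>M\<^esub> m' = m"
    and "\<And>t. t \<in> carrier M \<Longrightarrow> xs ! 0 \<odot>\<^bsub>M\<^esub> t = \<zero>\<^bsub>M\<^esub> \<Longrightarrow>
      \<exists>s\<in>carrier M. xs ! 0 \<odot>\<^bsub>M\<^esub> s = \<zero>\<^bsub>M\<^esub> \<and> xs ! 1 \<odot>\<^bsub>M\<^esub> s = t"
proof -
  have "xs \<noteq> []" using assms(2) by auto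
  then have surj: "(\<lambda>m. xs ! 0 \<odot>\<^bsub>M\<^esub> m) ` carrier M = carrier M"
    using assms(1) unfolding coregular_def by simp
  \<comment> \<open>With indices starting at 0, the condition at index 1 concerns the second entry
    acting on the kernel of the first.\<close>
  have "set (take 1 xs) = {xs ! 0}" using \<open>xs \<noteq> []\<close> by (cases xs) auto
  then have "annihilated_by M (set (take 1 xs)) = {m \<in> carrier M. xs ! 0 \<odot>\<^bsub>M\<^esub> m = \<zero>\<^bsub>M\<^esub>}"
    unfolding annihilated_by_def by simp
  moreover have "(\<lambda>m. xs ! 1 \<odot>\<^bsub>M\<^esub> m) ` annihilated_by M (set (take 1 xs)) =
      annihilated_by M (set (take 1 xs))"
    using assms unfolding coregular_def by simp
  ultimately have ker: "(\<lambda>m. xs ! 1 \<odot>\<^bsub>M\<^esub> m) ` {m \<in> carrier M. xs ! 0 \<odot>\<^bsub>M\<^esub> m = \<zero>\<^bsub>M\<^esub>} =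
      {m \<in> carrier M. xs ! 0 \<odot>\<^bsub>M\<^esub> m = \<zero>\<^bsub>M\<^esub>}" by simp
  show "\<exists>m'\<in>carrier M. xs ! 0 \<odot>\<^bsub>M\<^esub> m' = m" if "m \<in> carrier M" for m
  proof -
    have "m \<in> (\<lambda>m. xs ! 0 \<odot>\<^bsub>M\<^esub> m) ` carrier M" using surj that by simp
    then show ?thesis by auto
  qed
  show "\<exists>s\<in>carrier M. xs ! 0 \<odot>\<^bsub>M\<^esub> s = \<zero>\<^bsub>M\<^esub> \<and> xs ! 1 \<odot>\<^bsub>M\<^esub> s = t"
    if "t \<in> carrier M" "xs ! 0 \<odot>\<^bsub>M\<^esub> t = \<zero>\<^bsub>M\<^esub>" for t
  proof -
    have "t \<in> (\<lambda>m. xs ! 1 \<odot>\<^bsub>M\<^esub> m) ` {m \<in> carrier M. xs ! 0 \<odot>\<^bsub>M\<^esub> m = \<zero>\<^bsub>M\<^esub>}"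
      unfolding ker using that by simp
    then show ?thesis by auto
  qed
qed

section \<open>The local and the graded case\<close>

theorem theorem4p5:
  fixes R :: "('a, 'r) ring_scheme"
    and M :: "('a, 'b, 'm) module_scheme"
    and I :: "'a set"
    and A :: "nat \<Rightarrow> 'a set"
    and D :: "int \<Rightarrow> 'b set"
  assumes "module R M"
    and "ideal I R"
    and "carrier M \<noteq> {\<zero>\<^bsub>M\<^esub>}"
    and "Supp R M \<subseteq> zero_locus R I"
    and "countably_generated R M"
  shows "(noetherian_local_ring R \<and> codepth I M \<ge> 2 \<longrightarrow> quasi_cyclic R M) \<and>
         (standard_graded_ring R A \<and> graded_module R A M D \<and> homogeneous_ideal R A I \<and>
            graded_codepth A I M \<ge> 2 \<longrightarrow> graded_quasi_cyclic R M D)"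
proof -
  interpret module R M by fact
  have IR: "r \<in> carrier R" if "r \<in> I" for r
    using additive_subgroup.a_subset[OF ideal.axioms(1)[OF assms(2)]] that by auto
  note nil = locally_nilpotent[OF assms(4) _ IR]
  have "quasi_cyclic R M" if depth: "2 \<le> codepth I M"
  proof -
    obtain xs where "xs \<in> {xs. set xs \<subseteq> I \<and> coregular M xs}" and len: "2 \<le> length xs"
      using two_le_SUP_length[OF depth[unfolded codepth_def]] by blast
    then have xs: "set xs \<subseteq> I" "coregular M xs" by simp_all
    let ?x = "xs ! 0" and ?y = "xs ! 1"
    have "0 < length xs" "1 < length xs" using len by linarith+
    from this[THEN nth_mem] have xyI: "?x \<in> I" "?y \<in> I" using xs(1) by auto
    note xyR = IR[OF xyI(1)] IR[OF xyI(2)]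
    obtain T where T: "T \<subseteq> carrier M" "countable T" "gen_submodule R M T = carrier M"
      using assms(5) unfolding countably_generated_def by blast
    have "T \<noteq> {}"
    proof
      assume "T = {}"
      have "submodule {\<zero>\<^bsub>M\<^esub>} R M" by (rule submoduleI) auto
      from gen_submodule_minimal[OF this, of T] \<open>T = {}\<close> T(3) have "carrier M \<subseteq> {\<zero>\<^bsub>M\<^esub>}" by simp
      then show False using assms(3) M.zero_closed by auto
    qed
    show ?thesis unfolding quasi_cyclic_def
    proof (rule quasi_cyclic_byI[OF subset_refl _ T(1,2) \<open>T \<noteq> {}\<close> T(3)])
      fix u v assume uv: "u \<in> carrier M" "v \<in> carrier M"
      \<comment> \<open>These exponents make both sides of the Koszul cycle condition zero.\<close>
      obtain n m :: nat where nm: "?x [^]\<^bsub>R\<^esub> n \<odot>\<^bsub>M\<^esub> v = \<zero>\<^bsub>M\<^esub>" "?y [^]\<^bsub>R\<^esub> m \<odot>\<^bsub>M\<^esub> u = \<zero>\<^bsub>M\<^esub>"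
        using nil[OF xyI(1) xyI(1) uv(2)] nil[OF xyI(2) xyI(2) uv(1)] by blast
      then have "?y [^]\<^bsub>R\<^esub> m \<odot>\<^bsub>M\<^esub> u = ?x [^]\<^bsub>R\<^esub> n \<odot>\<^bsub>M\<^esub> v" by simp
      from koszul_exact[OF xyR coregular_pair[OF xs(2) len] uv this] obtain z where
        z: "z \<in> carrier M" "?x [^]\<^bsub>R\<^esub> n \<odot>\<^bsub>M\<^esub> z = u" "?y [^]\<^bsub>R\<^esub> m \<odot>\<^bsub>M\<^esub> z = v" by blast
      then have "u \<in> gen_submodule R M {z}" "v \<in> gen_submodule R M {z}"
        using gen_submodule_singleton[OF z(1)] xyR R.nat_pow_closed by auto
      with z(1) show "\<exists>z\<in>carrier M. u \<in> gen_submodule R M {z} \<and> v \<in> gen_submodule R M {z}"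
        by blast
    qed
  qed
  moreover have "graded_quasi_cyclic R M D"
    if graded: "standard_graded_ring R A" "graded_module R A M D" and depth: "2 \<le> graded_codepth A I M"
  proof -
    interpret standard_graded_module R M A D
      using graded by unfold_locales
    obtain xs where "xs \<in> {xs. set xs \<subseteq> I \<inter> homogeneous A \<and> coregular M xs}" and len: "2 \<le> length xs"
      using two_le_SUP_length[OF depth[unfolded graded_codepth_def]] by blast
    then have xs: "set xs \<subseteq> I \<inter> homogeneous A" "coregular M xs" by simp_all
    let ?x = "xs ! 0" and ?y = "xs ! 1"
    have "0 < length xs" "1 < length xs" using len by linarith+
    from this[THEN nth_mem] have xy: "?x \<in> I \<inter> homogeneous A" "?y \<in> I \<inter> homogeneous A"
      using xs(1) by auto
    then have xyI: "?x \<in> I" "?y \<in> I" by auto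
    obtain a b where a: "?x \<in> A a" and b: "?y \<in> A b"
      using xy unfolding homogeneous_def by blast
    note pair = coregular_pair[OF xs(2) len]
    obtain m where m: "m \<in> carrier M" "m \<noteq> \<zero>\<^bsub>M\<^esub>" using assms(3) M.zero_closed by auto
    obtain n1 n2 :: nat where n: "?x [^]\<^bsub>R\<^esub> n1 \<odot>\<^bsub>M\<^esub> m = \<zero>\<^bsub>M\<^esub>" "?y [^]\<^bsub>R\<^esub> n2 \<odot>\<^bsub>M\<^esub> m = \<zero>\<^bsub>M\<^esub>"
      using nil[OF xyI(1) xyI(1) m(1)] nil[OF xyI(2) xyI(2) m(1)] by blast
    have "0 < a"
    proof (rule ccontr)
      assume "\<not> 0 < a"
      \<comment> \<open>In degree 0 nilpotence on \<open>m\<close> forces \<open>?x\<close> to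
        vanish, which contradicts its surjectivity on a nonzero module.\<close>
      then have "?x = \<zero>\<^bsub>R\<^esub>" using scalar_locally_nilpotent_zero[OF _ m n(1)] a by simp
      then show False using pair(1)[OF m(1)] m(2) by auto
    qed
    moreover have "0 < b"
    proof (rule ccontr)
      assume "\<not> 0 < b"
      then have y0: "?y = \<zero>\<^bsub>R\<^esub>" using scalar_locally_nilpotent_zero[OF _ m n(2)] b by simp
      \<comment> \<open>If \<open>?y\<close> is zero, its surjectivity on the kernel of
        \<open>?x\<close> makes that kernel zero. Then \<open>?x\<close> is injective, so no power
        of it kills \<open>m\<close>.\<close>
      have inj: "t = \<zero>\<^bsub>M\<^esub>" if "t \<in> carrier M" "?x \<odot>\<^bsub>M\<^esub> t = \<zero>\<^bsub>M\<^esub>" for t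
        using pair(2)[OF that] unfolding y0 by auto
      have "?x [^]\<^bsub>R\<^esub> k \<odot>\<^bsub>M\<^esub> m \<noteq> \<zero>\<^bsub>M\<^esub>" for k :: nat
      proof (induction k)
        case 0
        then show ?case using m by simp
      next
        case (Suc k)
        then show ?case
          using inj[of "?x [^]\<^bsub>R\<^esub> k \<odot>\<^bsub>M\<^esub> m"] smult_pow_Suc2[OF IR[OF xyI(1)] m(1)] IR[OF xyI(1)] m(1)
          by auto
      qed
      then show False using n(1) by simp
    qed
    ultimately interpret graded_coregular_pair R M A D ?x ?y a b
      using a b pair nil[OF xyI(1) xyI(1)] nil[OF xyI(2) xyI(2)] by unfold_locales
    obtain S where S: "S \<subseteq> homogeneous D" "countable S" "S \<noteq> {}" "gen_submodule R M S = carrier M"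
      using homogeneous_generators[OF assms(5)] by blast
    have "homogeneous D \<subseteq> carrier M" unfolding homogeneous_def using mdeg_carrier by blast
    from quasi_cyclic_byI[OF this homogeneous_cyclic S] show ?thesis
      unfolding graded_quasi_cyclic_def .
  qed
  ultimately show ?thesis by blast
qed

end
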